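(* Let $n\ge2$. The $n$-dimensional Selmer algorithm $(X,T)$, $X=\Delta(n-1)\cup\Delta(n)$, is algebraic self-dual, with intertwining map $\phi$ the fractional linear map associated with the symmetric $(n+1)\times(n+1)$ matrix $A_\phi=(a_{ij})_{0\le i,j\le n}$ given by $a_{ij}=2$ if $i+j\le n-2$, $a_{nn}=0$, and $a_{ij}=1$ otherwise. That is, $\phi$ is a differentiable bijection from $\mathring{X^{\#}}$ onto $\mathring{X}$, and for $k\in\{n-1,n\}$ one has $\phi(\mathring{X^{\#}(k)})=\mathring{\Delta(k)}$ and $\phi\circ T^{\#}=T\circ\phi$ on $\mathring{X^{\#}(k)}$.
   Context: For an invertible matrix $A=(A_{ij})_{0\le i,j\le n}$ the associated fractional linear map is $x\mapsto y$ with $y_i=\dfrac{A_{i0}+\sum_{j=1}^nA_{ij}x_j}{A_{00}+\sum_{j=1}^nA_{0j}x_j}$, $1\le i\le n$. The symbol $\mathring{\ }$ denotes interior in $\mathbb{R}^n$. Selmer algorithm: $\Delta=\{x\in\mathbb{R}^n:1\ge x_1\ge\cdots\ge x_n\ge0\}$. With $x_0=1$, $x_{n+1}=0$, put $\Delta(i)=\{x\in\Delta:x_i>1-x_n\ge x_{i+1}\}$. The map replaces $x_0$ by $x_0-x_n$ in $(x_0,\dots,x_n)$, reorders decreasingly and normalizes by the first coordinate. One restricts to $X=\Delta(n-1)\cup\Delta(n)$, where the system is full, and where explicitly $$T(x)=\left(\tfrac{x_2}{x_1},\dots,\tfrac{x_{n-1}}{x_1},\tfrac{1-x_n}{x_1},\tfrac{x_n}{x_1}\right)\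 \text{on }\Delta(n-1),\qquad T(x)=\left(\tfrac{x_2}{x_1},\dots,\tfrac{x_n}{x_1},\tfrac{1-x_n}{x_1}\right)\ \text{on }\Delta(n).$$ Dual algorithm (given on each piece by the transposed matrices of $T$): $X^{\#}=\{x\in\mathbb{R}^n:x_i\ge0\ \forall i\}$, with $X^{\#}(n-1)=\{x\in X^{\#}:x_{n-1}\le x_n\}$, $X^{\#}(n)=\{x\in X^{\#}:x_{n-1}\ge x_n\}$ (a partition up to boundary), and, with $x_0=1$, $$T^{\#}(x)=\left(\tfrac{x_0}{x_{n-1}},\tfrac{x_1}{x_{n-1}},\dots,\tfrac{x_{n-2}}{x_{n-1}},\tfrac{x_n-x_{n-1}}{x_{n-1}}\right)\ \text{on }X^{\#}(n-1),$$ $$T^{\#}(x)=\left(\tfrac{x_0}{x_n},\tfrac{x_1}{x_n},\dots,\tfrac{x_{n-2}}{x_n},\tfrac{x_{n-1}-x_n}{x_n}\right)\ \text{on }X^{\#}(n).$$ Algebraic self-dual means: there is a bijective, differentiable, measurable $\phi:X^{\#}\to X$ with $\phi\circ T^{\#}=T\circ\phi$ and $\phi(\mathring{X^{\#}(k)})=\mathring{\Delta(k)}$ for all digits $k$; as usual for these systems, this is understood up to boundary (Lebesgue-null) sets, as spelled out in the claim. *)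

theory Defs
  imports "HOL-Analysis.Analysis"
begin

text \<open>
  Points of \<open>\<real>\<^sup>n\<close> are vectors of type \<open>real^'n\<close> with \<open>n = CARD('n)\<close>.  The algorithms depend on the
  order of the coordinates, so everything is parametrized by a numbering \<open>e\<close> of the index type,
  meant to be a bijection from \<open>{1..n}\<close> onto \<open>'n\<close>: the coordinate \<open>x\<^sub>i\<close> is \<open>x $ e i\<close>.
\<close>

definition numbering :: "(nat \<Rightarrow> 'n::finite) \<Rightarrow> bool"
  where "numbering e \<longleftrightarrow> bij_betw e {1..CARD('n)} UNIV"

definition index_of :: "(nat \<Rightarrow> 'n::finite) \<Rightarrow> 'n \<Rightarrow> nat"
  where "index_of e k = inv_into {1..CARD('n)} e k"

text \<open>The coordinates of a point, extended by \<open>x\<^sub>0 = 1\<close> and \<open>x\<^sub>n\<^sub>+\<^sub>1 = 0\<close>.\<close>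

definition coord :: "(nat \<Rightarrow> 'n::finite) \<Rightarrow> real^'n \<Rightarrow> nat \<Rightarrow> real"
  where "coord e x i = (if i = 0 then 1 else if i \<le> CARD('n) then x $ e i else 0)"

definition of_coords :: "(nat \<Rightarrow> 'n::finite) \<Rightarrow> (nat \<Rightarrow> real) \<Rightarrow> real^'n"
  where "of_coords e y = (\<chi> k. y (index_of e k))"


subsection \<open>The Selmer algorithm\<close>

definition selmer_simplex :: "(nat \<Rightarrow> 'n::finite) \<Rightarrow> (real^'n) set"
  where "selmer_simplex e = {x. \<forall>i\<le>CARD('n). coord e x i \<ge> coord e x (i + 1)}"

definition selmer_cell :: "(nat \<Rightarrow> 'n::finite) \<Rightarrow> nat \<Rightarrow> (real^'n) set"
  where "selmer_cell e i = {x \<in> selmer_simplex e.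
    coord e x i > 1 - coord e x CARD('n) \<and> 1 - coord e x CARD('n) \<ge> coord e x (i + 1)}"

definition selmer_digits :: "'n::finite itself \<Rightarrow> nat set"
  where "selmer_digits _ = {CARD('n) - 1, CARD('n)}"

definition selmer_space :: "(nat \<Rightarrow> 'n::finite) \<Rightarrow> (real^'n) set"
  where "selmer_space e = selmer_cell e (CARD('n) - 1) \<union> selmer_cell e CARD('n)"

text \<open>The two cells are disjoint; the values outside \<open>selmer_space e\<close> are irrelevant.\<close>

definition selmer_map :: "(nat \<Rightarrow> 'n::finite) \<Rightarrow> real^'n \<Rightarrow> real^'n"
  where "selmer_map e x = (let n = CARD('n); x' = coord e x in
    if x \<in> selmer_cell e (n - 1) then
      of_coords e (\<lambda>i. if i < n - 1 then x' (i + 1) / x' 1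
                       else if i = n - 1 then (1 - x' n) / x' 1
                       else x' n / x' 1)
    else
      of_coords e (\<lambda>i. if i < n then x' (i + 1) / x' 1 else (1 - x' n) / x' 1))"


subsection \<open>The dual algorithm\<close>

definition dual_space :: "(real^'n::finite) set"
  where "dual_space = {x. \<forall>k. x $ k \<ge> 0}"

definition dual_cell :: "(nat \<Rightarrow> 'n::finite) \<Rightarrow> nat \<Rightarrow> (real^'n) set"
  where "dual_cell e i = {x \<in> dual_space.
    (i = CARD('n) - 1 \<and> coord e x (CARD('n) - 1) \<le> coord e x CARD('n)) \<or>
    (i = CARD('n) \<and> coord e x (CARD('n) - 1) \<ge> coord e x CARD('n))}"

text \<open>
  The two cells overlap in the null set \<open>x\<^sub>n\<^sub>-\<^sub>1 = x\<^sub>n\<close>, where the first branch is taken; the divisors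
  vanish only on the boundary of the orthant.
\<close>

definition dual_map :: "(nat \<Rightarrow> 'n::finite) \<Rightarrow> real^'n \<Rightarrow> real^'n"
  where "dual_map e x = (let n = CARD('n); x' = coord e x in
    if x \<in> dual_cell e (n - 1) then
      of_coords e (\<lambda>i. if i < n then x' (i - 1) / x' (n - 1) else (x' n - x' (n - 1)) / x' (n - 1))
    else
      of_coords e (\<lambda>i. if i < n then x' (i - 1) / x' n else (x' (n - 1) - x' n) / x' n))"


subsection \<open>Fractional linear maps\<close>

text \<open>
  Matrices with index range \<open>0, \<dots>, n\<close> have index type \<open>'n option\<close>: \<open>None\<close> is the index \<open>0\<close> and
  \<open>Some (e i)\<close> is the index \<open>i \<in> {1..n}\<close>.
\<close>

definition frac_linear :: "real^('n::finite option)^('n option) \<Rightarrow> real^'n \<Rightarrow> real^'n"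
  where "frac_linear A x = (\<chi> k.
    (A $ Some k $ None + (\<Sum>j\<in>UNIV. A $ Some k $ Some j * x $ j)) /
    (A $ None $ None + (\<Sum>j\<in>UNIV. A $ None $ Some j * x $ j)))"

definition matrix_of_entries ::
    "(nat \<Rightarrow> 'n::finite) \<Rightarrow> (nat \<Rightarrow> nat \<Rightarrow> real) \<Rightarrow> real^('n option)^('n option)"
  where "matrix_of_entries e a =
    (let ix = case_option 0 (index_of e) in \<chi> r c. a (ix r) (ix c))"

definition selmer_dual_matrix :: "(nat \<Rightarrow> 'n::finite) \<Rightarrow> real^('n option)^('n option)"
  where "selmer_dual_matrix e = (let n = CARD('n) in matrix_of_entries e
    (\<lambda>i j. if i + j \<le> n - 2 then 2 else if i = n \<and> j = n then 0 else 1))"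


subsection \<open>Algebraic self-duality\<close>

text \<open>
  A system is given by its space, its cells (indexed by a set \<open>K\<close> of digits) and its map.  The
  conditions are imposed up to the boundaries of the spaces and of the cells.
\<close>

definition algebraic_self_dual_via ::
    "'k set \<Rightarrow> (real^'n::finite) set \<Rightarrow> ('k \<Rightarrow> (real^'n) set) \<Rightarrow> (real^'n \<Rightarrow> real^'n) \<Rightarrow>
     (real^'n) set \<Rightarrow> ('k \<Rightarrow> (real^'n) set) \<Rightarrow> (real^'n \<Rightarrow> real^'n) \<Rightarrow> (real^'n \<Rightarrow> real^'n) \<Rightarrow> bool"
  where "algebraic_self_dual_via K X C T Xd Cd Td \<phi> \<longleftrightarrow>
    bij_betw \<phi> (interior Xd) (interior X) \<and>
    \<phi> differentiable_on interior Xd \<and>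
    \<phi> \<in> borel_measurable (restrict_space borel (interior Xd)) \<and>
    (\<forall>k\<in>K. \<phi> ` interior (Cd k) = interior (C k) \<and>
      (\<forall>x\<in>interior (Cd k). \<phi> (Td x) = T (\<phi> x)))"

end

theory Submission
  imports Defs
begin

text \<open>
  Let \<open>A\<close> be the matrix of the theorem and \<open>N = A (1, x\<^sub>1, \<dots>, x\<^sub>n)\<close>.  Consecutive rows of \<open>A\<close>
  differ in a single entry, so \<open>N\<^sub>i - N\<^sub>i\<^sub>+\<^sub>1 = x\<^sub>n\<^sub>-\<^sub>2\<^sub>-\<^sub>i\<close> for \<open>i \<le> n - 2\<close>, \<open>N\<^sub>n\<^sub>-\<^sub>1 - N\<^sub>n = x\<^sub>n\<close>
  and \<open>N\<^sub>n\<^sub>-\<^sub>1 + N\<^sub>n - N\<^sub>0 = x\<^sub>n\<^sub>-\<^sub>1\<close>.  These functionals invert \<open>A\<close>, and up to the positive factor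
  \<open>N\<^sub>0\<close> they are the slacks of the inequalities that define the Selmer space at
  \<open>y = \<phi>(x) = (N\<^sub>1/N\<^sub>0, \<dots>, N\<^sub>n/N\<^sub>0)\<close>.  Hence \<open>\<phi>\<close> maps the open orthant onto the interior of the
  Selmer space, and the sign of \<open>x\<^sub>n\<^sub>-\<^sub>1 - x\<^sub>n\<close>, which is that of \<open>2y\<^sub>n - 1\<close>, selects the same digit
  on both sides.  The intertwining relation is verified by comparing the functionals.
\<close>

section \<open>The matrix and its inverse on plain sequences\<close>

text \<open>Natural number indices keep the linear algebra apart from the index type of the vectors;
  \<open>selmer_dual_matrix_nth\<close> makes the link to the actual matrix.\<close>

definition selmer_entry :: "nat \<Rightarrow> nat \<Rightarrow> nat \<Rightarrow> real"
  where "selmer_entry n i j = (if i + j \<le> n - 2 then 2 else if i = n \<and> j = n then 0 else 1)"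

definition selmer_apply :: "nat \<Rightarrow> (nat \<Rightarrow> real) \<Rightarrow> nat \<Rightarrow> real"
  where "selmer_apply n f i = (\<Sum>j\<le>n. selmer_entry n i j * f j)"

text \<open>This is the inverse matrix. The differences run backwards because row
  \<open>n - 2 - j\<close> is the one whose last entry 2 stands in column \<open>j\<close>.\<close>

definition slack :: "nat \<Rightarrow> (nat \<Rightarrow> real) \<Rightarrow> nat \<Rightarrow> real"
  where "slack n g j =
    (if j + 2 \<le> n then g (n - 2 - j) - g (n - 1 - j)
     else if j + 1 = n then g (n - 1) + g n - g 0
     else g (n - 1) - g n)"

lemma slack_cong:
  assumes "\<And>i. i \<le> n \<Longrightarrow> g i = h i"
  shows "slack n g j = slack n h j"
  using assms by (simp add: slack_def)

lemma slack_divide: "slack n (\<lambda>i. g i / c) j = slack n g j / c"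
  by (simp add: slack_def diff_divide_distrib add_divide_distrib)

lemma selmer_apply_divide: "selmer_apply n (\<lambda>i. f i / c) i = selmer_apply n f i / c"
  by (simp add: selmer_apply_def sum_divide_distrib)

lemma selmer_apply_cong:
  assumes "\<And>j. j \<le> n \<Longrightarrow> f j = g j"
  shows "selmer_apply n f i = selmer_apply n g i"
  using assms by (simp add: selmer_apply_def)

lemma selmer_apply_pos:
  assumes "n \<ge> 2" "i \<le> n" and pos: "\<And>j. j \<le> n \<Longrightarrow> f j > 0"
  shows "selmer_apply n f i > 0"
proof -
  \<comment> \<open>The only zero of the matrix is at (n, n), so column 0 is positive in every row,
    and no other term is negative.\<close>
  have "0 < selmer_entry n i 0 * f 0"
    using assms by (auto simp: selmer_entry_def)
  moreover have "0 \<le> selmer_entry n i j * f j" if "j \<le> n" for j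
    using pos[OF that] by (simp add: selmer_entry_def)
  ultimately show ?thesis
    unfolding selmer_apply_def by (intro sum_pos2[where i = 0]) auto
qed

text \<open>Each \<open>slack\<close> functional combines the rows of the matrix to a unit row, and
  \<open>delta\<close> then picks out \<open>f j\<close>.\<close>

lemma slack_selmer_apply:
  assumes "n \<ge> 2" "j \<le> n"
  shows "slack n (selmer_apply n f) j = f j"
proof -
  have delta: "(\<Sum>k\<le>n. c k * f k) = f j" if "\<And>k. k \<le> n \<Longrightarrow> c k = (if k = j then 1 else 0)" for c
  proof -
    have "(\<Sum>k\<le>n. c k * f k) = (\<Sum>k\<le>n. if k = j then f k else 0)"
      using that by (intro sum.cong) auto
    then show ?thesis
      using assms by simp
  qed
  consider i where "n = i + j + 2" | "n = j + 1" | "n = j"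
    using assms by (metis add.commute add.assoc le_Suc_ex le_antisym not_less_eq_eq
        Suc_eq_plus1 add_2_eq_Suc')
  then show ?thesis
  proof cases
    case 1
    then have "slack n (selmer_apply n f) j =
        (\<Sum>k\<le>n. (selmer_entry n i k - selmer_entry n (i + 1) k) * f k)"
      by (simp add: slack_def selmer_apply_def sum_subtractf left_diff_distrib)
    \<comment> \<open>Rows \<open>i\<close> and \<open>i + 1\<close> differ only in column n - 2 - i
      = j, where the entry drops from 2 to 1.\<close>
    also have "\<dots> = f j"
      using 1 by (intro delta) (simp add: selmer_entry_def)
    finally show ?thesis .
  next
    case 2
    then have "slack n (selmer_apply n f) j =
        (\<Sum>k\<le>n. (selmer_entry n j k + selmer_entry n n k - selmer_entry n 0 k) * f k)"
      by (simp add: slack_def selmer_apply_def sum_subtractf sum.distrib left_diff_distrib distrib_right)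
    \<comment> \<open>Rows n - 1 and n consist of ones except for the 0 at (n, n), so their sum is 2
      up to column n - 1 and 1 in column n. Row 0 drops from 2 to 1 after column n - 2; subtracting
      it leaves a single 1 in column n - 1.\<close>
    also have "\<dots> = f j"
    proof (rule delta)
      fix k assume "k \<le> n"
      with 2 assms consider "k \<le> n - 2" "k \<noteq> j" "k \<noteq> n" | "k = j" | "k = n"
        by linarith
      then show "selmer_entry n j k + selmer_entry n n k - selmer_entry n 0 k = (if k = j then 1 else 0)"
        using 2 assms by cases (simp_all add: selmer_entry_def)
    qed
    finally show ?thesis .
  next
    case 3
    then have "slack n (selmer_apply n f) j =
        (\<Sum>k\<le>n. (selmer_entry n (n - 1) k - selmer_entry n n k) * f k)"
      by (simp add: slack_def selmer_apply_def sum_subtractf left_diff_distrib)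
    also have "\<dots> = f j"
    proof (rule delta)
      have "n - 1 \<noteq> n" "\<not> n - 1 + k \<le> n - 2" "\<not> n + k \<le> n - 2" for k
        using assms by linarith+
      then show "selmer_entry n (n - 1) k - selmer_entry n n k = (if k = j then 1 else 0)" for k
        using 3 by (simp add: selmer_entry_def)
    qed
    finally show ?thesis .
  qed
qed

text \<open>The vanishing differences make \<open>g\<close> constant, and the slack with index
  \<open>n - 1\<close> is then this constant itself.\<close>

lemma slack_eq_0_imp:
  assumes "n \<ge> 2" and zero: "\<And>j. j \<le> n \<Longrightarrow> slack n g j = 0" and "i \<le> n"
  shows "g i = 0"
proof -
  have step: "g i = g (Suc i)" if "Suc i \<le> n" for i
  proof (cases "i + 2 \<le> n")
    case True
    \<comment> \<open>The difference of the entries at \<open>i\<close> and \<open>Suc i\<close> is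
      the slack with index \<open>n - 2 - i\<close>.\<close>
    then have "n - 2 - (n - 2 - i) = i" "n - 1 - (n - 2 - i) = Suc i" "n - 2 - i + 2 \<le> n"
      by auto
    then show ?thesis
      using zero[of "n - 2 - i"] by (simp add: slack_def)
  next
    case False
    then have "n = Suc i"
      using that by simp
    then show ?thesis
      using zero[of n] by (simp add: slack_def)
  qed
  have const: "g i = g 0" if "i \<le> n" for i
    using that
  proof (induction i)
    case (Suc i)
    then show ?case
      using step[of i] by simp
  qed simp
  have "g (n - 1) + g n - g 0 = 0"
    using zero[of "n - 1"] \<open>n \<ge> 2\<close> by (simp add: slack_def)
  then show ?thesis
    using const[of "n - 1"] const[of n] const[OF \<open>i \<le> n\<close>] by simp
qed

lemma slack_inject:
  assumes "n \<ge> 2" and eq: "\<And>j. j \<le> n \<Longrightarrow> slack n g j = slack n h j" and "i \<le> n"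
  shows "g i = h i"
proof -
  have "slack n (\<lambda>i. g i - h i) j = 0" if "j \<le> n" for j
    using eq[OF that] by (auto simp: slack_def split: if_splits)
  then show ?thesis
    using slack_eq_0_imp[OF \<open>n \<ge> 2\<close> _ \<open>i \<le> n\<close>, of "\<lambda>i. g i - h i"] by simp
qed

text \<open>The second inverse law needs no further computation: both sides have the same slacks by
  the first law, and \<open>slack\<close> is injective.\<close>

lemma selmer_apply_slack:
  assumes "n \<ge> 2" "i \<le> n"
  shows "selmer_apply n (slack n g) i = g i"
  using slack_inject[OF \<open>n \<ge> 2\<close> slack_selmer_apply[OF \<open>n \<ge> 2\<close>] \<open>i \<le> n\<close>] .

section \<open>The two branches in homogeneous coordinates\<close>

text \<open>This is the intertwining relation for the digit n - 1 with denominators cleared: on the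
  left stands the Selmer branch applied to \<open>g\<close>, on the right the dual branch applied to
  the slacks of \<open>g\<close>.\<close>

lemma slack_shift_low:
  assumes "n \<ge> 2" "j \<le> n"
  shows "slack n (\<lambda>i. if i + 1 < n then g (i + 1) else if i + 1 = n then g 0 - g n else g n) j =
    (if j = 0 then slack n g (n - 1) else if j < n then slack n g (j - 1)
     else slack n g n - slack n g (n - 1))"
proof -
  obtain m where m: "n = Suc (Suc m)"
    using assms(1) by (metis add_2_eq_Suc le_Suc_ex)
  \<comment> \<open>The parametrization by \<open>m\<close>, \<open>l\<close> and \<open>r\<close>
    makes every truncated subtraction explicit, so that simplification evaluates both sides.\<close>
  consider "j = 0" | l r where "j = Suc l" "m = l + r + 1" | "j = Suc m" | "j = Suc (Suc m)"
    using assms(2) unfolding m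
    by (cases j) (auto simp: le_Suc_eq dest: le_Suc_ex)
  then show ?thesis
    by cases (simp_all add: m slack_def)
qed

text \<open>The same relation for the digit n.\<close>

lemma slack_shift_high:
  assumes "n \<ge> 2" "j \<le> n"
  shows "slack n (\<lambda>i. if i < n then g (i + 1) else g 0 - g n) j =
    (if j = 0 then slack n g n else if j < n then slack n g (j - 1)
     else slack n g (n - 1) - slack n g n)"
proof -
  obtain m where m: "n = Suc (Suc m)"
    using assms(1) by (metis add_2_eq_Suc le_Suc_ex)
  consider "j = 0" | l r where "j = Suc l" "m = l + r + 1" | "j = Suc m" | "j = Suc (Suc m)"
    using assms(2) unfolding m
    by (cases j) (auto simp: le_Suc_eq dest: le_Suc_ex)
  then show ?thesis
    by cases (simp_all add: m slack_def)
qed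

section \<open>Positivity of slacks and analytic tools\<close>

text \<open>All slacks except the one with index \<open>n - 1\<close> are consecutive differences;
  the normalization \<open>g 0 = 1\<close> turns the remaining one into the condition on the sum.
  This will describe the interior of the Selmer space.\<close>

lemma slack_pos_iff:
  assumes "n \<ge> 2" and "g 0 = 1"
  shows "(\<forall>j\<le>n. slack n g j > 0) \<longleftrightarrow> (\<forall>i<n. g i > g (Suc i)) \<and> g (n - 1) + g n > 1"
proof
  assume pos: "\<forall>j\<le>n. slack n g j > 0"
  have "g i > g (Suc i)" if "i < n" for i
  proof (cases "i + 2 \<le> n")
    case True
    then have "n - 2 - (n - 2 - i) = i" "n - 1 - (n - 2 - i) = Suc i" "n - 2 - i + 2 \<le> n"
      by auto
    then show ?thesis
      using spec[OF pos, of "n - 2 - i"] by (simp add: slack_def)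
  next
    case False
    then have "n = Suc i"
      using that by simp
    then show ?thesis
      using spec[OF pos, of n] by (simp add: slack_def)
  qed
  moreover have "g (n - 1) + g n > 1"
    using spec[OF pos, of "n - 1"] assms by (simp add: slack_def)
  ultimately show "(\<forall>i<n. g i > g (Suc i)) \<and> g (n - 1) + g n > 1"
    by blast
next
  assume *: "(\<forall>i<n. g i > g (Suc i)) \<and> g (n - 1) + g n > 1"
  show "\<forall>j\<le>n. slack n g j > 0"
  proof (intro allI impI)
    fix j assume "j \<le> n"
    then consider "j + 2 \<le> n" | "j + 1 = n" | "j = n"
      by linarith
    then show "slack n g j > 0"
    proof cases
      case 1
      then have "Suc (n - 2 - j) = n - 1 - j" "n - 2 - j < n"
        by auto
      then show ?thesis
        using 1 * by (metis slack_def diff_gt_0_iff_gt)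
    next
      case 2
      then show ?thesis
        using * assms by (simp add: slack_def)
    next
      case 3
      have "g (Suc (n - 1)) < g (n - 1)"
        using * \<open>n \<ge> 2\<close> by (meson diff_less less_le_trans zero_less_one pos2)
      then show ?thesis
        using 3 \<open>n \<ge> 2\<close> by (simp add: slack_def)
    qed
  qed
qed

text \<open>Serves to make inequalities strict: a weak inequality that still holds after one
  coordinate is moved in the unfavourable direction was strict before.\<close>

lemma interior_axis_perturb:
  fixes x :: "real^'n::finite"
  assumes "x \<in> interior S"
  obtains t where "t > 0" "x + axis k t \<in> S" "x + axis k (- t) \<in> S"
proof -
  obtain r where r: "r > 0" "ball x r \<subseteq> S"
    using assms by (auto simp: mem_interior)
  have "x + axis k s \<in> S" if "\<bar>s\<bar> < r" for s
  proof -
    have "dist x (x + axis k s) = \<bar>s\<bar>"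
      by (simp add: dist_norm norm_eq_sqrt_inner inner_axis_axis)
    then show ?thesis
      using r that by (auto simp: subset_iff)
  qed
  then show thesis
    using that[of "r / 2"] r(1) by simp
qed

lemma differentiable_frac_linear:
  fixes x :: "real^'n::finite"
  assumes "A $ None $ None + (\<Sum>j\<in>UNIV. A $ None $ Some j * x $ j) \<noteq> 0"
  shows "frac_linear A differentiable (at x)"
proof -
  have nth: "(\<lambda>x. x $ j) differentiable (at x)" for j
    by (intro bounded_linear_imp_differentiable bounded_linear_vec_nth)
  show ?thesis
    unfolding differentiable_componentwise_within[of "frac_linear A"] using assms
    by (auto simp: Basis_vec_def inner_axis frac_linear_def nth)
qed

section \<open>Coordinates under a fixed numbering\<close>

context
  fixes e :: "nat \<Rightarrow> 'n::finite" and n :: nat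
  assumes n_ge_2: "n \<ge> 2" and n_eq: "CARD('n) = n" and numbering: "numbering e"
begin

lemma index_of_e: "i \<in> {1..n} \<Longrightarrow> index_of e (e i) = i"
  using numbering inv_into_f_f[of e "{1..n}" i]
  by (auto simp: numbering_def index_of_def bij_betw_def n_eq)

lemma e_index_of: "e (index_of e k) = k" and index_of_in: "index_of e k \<in> {1..n}"
  using numbering f_inv_into_f[of k e "{1..n}"] inv_into_into[of k e "{1..n}"]
  by (auto simp: numbering_def index_of_def bij_betw_def n_eq)

lemma coord_0: "coord e x 0 = 1"
  by (simp add: coord_def)

lemma coord_beyond: "i > n \<Longrightarrow> coord e x i = 0"
  by (simp add: coord_def n_eq)

lemma coord_of_coords: "i \<in> {1..n} \<Longrightarrow> coord e (of_coords e g) i = g i"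
  by (simp add: coord_def of_coords_def index_of_e n_eq)

lemma coord_index_of: "coord e x (index_of e k) = x $ k"
  using index_of_in[of k] by (simp add: coord_def e_index_of n_eq)

lemma coord_eqI:
  assumes "\<And>i. i \<in> {1..n} \<Longrightarrow> coord e x i = coord e y i"
  shows "x = y"
  using assms index_of_in by (simp add: vec_eq_iff flip: coord_index_of)

lemma coord_add_axis:
  assumes "k \<in> {1..n}"
  shows "coord e (x + axis (e k) t) i = coord e x i + (if i = k then t else 0)"
proof -
  have "e i = e k \<longleftrightarrow> i = k" if "i \<in> {1..n}"
    using that assms index_of_e by metis
  then show ?thesis
    using assms by (auto simp: coord_def axis_def n_eq)
qed

lemma continuous_on_coord: "continuous_on S (\<lambda>x. coord e x i)"
  by (cases "i = 0"; cases "i \<le> n") (auto simp: coord_def n_eq intro!: continuous_intros)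

lemma open_coord_pos: "open {x. \<forall>i\<le>n. coord e x i > 0}"
proof -
  have "{x. \<forall>i\<le>n. coord e x i > 0} = (\<Inter>i\<in>{..n}. {x. 0 < coord e x i})"
    by auto
  then show ?thesis
    by (simp add: open_INT open_Collect_less continuous_on_coord)
qed

lemma continuous_on_slack_coord: "continuous_on S (\<lambda>x. slack n (coord e x) j)"
  by (cases "j + 2 \<le> n"; cases "j + 1 = n")
    (auto simp: slack_def intro!: continuous_intros continuous_on_coord)

lemma open_slack_pos: "open {y. \<forall>j\<le>n. slack n (coord e y) j > 0}"
proof -
  have "{y. \<forall>j\<le>n. slack n (coord e y) j > 0} = (\<Inter>j\<in>{..n}. {y. 0 < slack n (coord e y) j})"
    by auto
  then show ?thesis
    by (simp add: open_INT open_Collect_less continuous_on_slack_coord)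
qed

section \<open>Interiors of the dual space and its cells\<close>

lemma dual_space_eq: "dual_space = {x. \<forall>i\<le>n. coord e x i \<ge> 0}"
proof -
  have "(\<forall>k. x $ k \<ge> 0) \<longleftrightarrow> (\<forall>i\<le>n. coord e x i \<ge> 0)" for x :: "real^'n"
  proof
    assume nonneg: "\<forall>k. x $ k \<ge> 0"
    show "\<forall>i\<le>n. coord e x i \<ge> 0"
      using nonneg by (simp add: coord_def)
  next
    assume nonneg: "\<forall>i\<le>n. coord e x i \<ge> 0"
    show "\<forall>k. x $ k \<ge> 0"
    proof
      fix k
      have "coord e x (index_of e k) \<ge> 0"
        using nonneg index_of_in[of k] by simp
      then show "x $ k \<ge> 0"
        by (simp add: coord_index_of)
    qed
  qed
  then show ?thesis
    by (simp add: dual_space_def)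
qed

lemma interior_dual_space_imp:
  assumes "x \<in> interior dual_space" "i \<le> n"
  shows "coord e x i > 0"
proof (cases "i = 0")
  case False
  obtain t where t: "t > 0" "x + axis (e i) (- t) \<in> dual_space"
    using interior_axis_perturb[OF assms(1)] by metis
  have "coord e (x + axis (e i) (- t)) i \<ge> 0"
    using t(2) assms(2) by (simp add: dual_space_eq)
  then show ?thesis
    using t(1) False assms(2) coord_add_axis[of i x "- t" i] by simp
qed (simp add: coord_0)

lemma interior_dual_space: "interior dual_space = {x. \<forall>i\<le>n. coord e x i > 0}"
proof (rule interior_unique)
  show "{x. \<forall>i\<le>n. coord e x i > 0} \<subseteq> dual_space"
    by (auto simp: dual_space_eq less_imp_le)
  show "T \<subseteq> {x. \<forall>i\<le>n. coord e x i > 0}" if "T \<subseteq> dual_space" "open T" for T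
    using interior_maximal[OF that] interior_dual_space_imp by auto
qed (rule open_coord_pos)

lemma dual_cell_low:
  "dual_cell e (n - 1) = {x \<in> dual_space. coord e x (n - 1) \<le> coord e x n}"
  and dual_cell_high:
  "dual_cell e n = {x \<in> dual_space. coord e x (n - 1) \<ge> coord e x n}"
  using n_ge_2 by (auto simp: dual_cell_def n_eq)

lemma interior_dual_cell_low:
  "interior (dual_cell e (n - 1)) =
    {x. (\<forall>i\<le>n. coord e x i > 0) \<and> coord e x (n - 1) < coord e x n}" (is "_ = ?O")
proof
  show "interior (dual_cell e (n - 1)) \<subseteq> ?O"
  proof
    fix x assume x: "x \<in> interior (dual_cell e (n - 1))"
    moreover have "interior (dual_cell e (n - 1)) \<subseteq> interior dual_space"
      unfolding dual_cell_low by (intro interior_mono) auto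
    ultimately have "\<forall>i\<le>n. coord e x i > 0"
      using interior_dual_space by blast
    \<comment> \<open>Lowering x_n is the unfavourable direction for x_(n-1) <= x_n; for the other
      cell x_n is raised.\<close>
    moreover obtain t where t: "t > 0" "x + axis (e n) (- t) \<in> dual_cell e (n - 1)"
      using interior_axis_perturb[OF x] by metis
    have "coord e x (n - 1) < coord e x n"
      using t n_ge_2 unfolding dual_cell_low by (auto simp: coord_add_axis split: if_splits)
    ultimately show "x \<in> ?O"
      by simp
  qed
  have "?O = {x. \<forall>i\<le>n. coord e x i > 0} \<inter> {x. coord e x (n - 1) < coord e x n}"
    by auto
  then have "open ?O"
    by (simp only:) (intro open_Int open_coord_pos open_Collect_less continuous_on_coord)
  then show "?O \<subseteq> interior (dual_cell e (n - 1))"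
    unfolding dual_cell_low dual_space_eq by (intro interior_maximal) (auto simp: less_imp_le)
qed

lemma interior_dual_cell_high:
  "interior (dual_cell e n) =
    {x. (\<forall>i\<le>n. coord e x i > 0) \<and> coord e x n < coord e x (n - 1)}" (is "_ = ?O")
proof
  show "interior (dual_cell e n) \<subseteq> ?O"
  proof
    fix x assume x: "x \<in> interior (dual_cell e n)"
    moreover have "interior (dual_cell e n) \<subseteq> interior dual_space"
      unfolding dual_cell_high by (intro interior_mono) auto
    ultimately have "\<forall>i\<le>n. coord e x i > 0"
      using interior_dual_space by blast
    moreover obtain t where t: "t > 0" "x + axis (e n) t \<in> dual_cell e n"
      using interior_axis_perturb[OF x] by metis
    have "coord e x n < coord e x (n - 1)"
      using t n_ge_2 unfolding dual_cell_high by (auto simp: coord_add_axis split: if_splits)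
    ultimately show "x \<in> ?O"
      by simp
  qed
  have "?O = {x. \<forall>i\<le>n. coord e x i > 0} \<inter> {x. coord e x n < coord e x (n - 1)}"
    by auto
  then have "open ?O"
    by (simp only:) (intro open_Int open_coord_pos open_Collect_less continuous_on_coord)
  then show "?O \<subseteq> interior (dual_cell e n)"
    unfolding dual_cell_high dual_space_eq by (intro interior_maximal) (auto simp: less_imp_le)
qed

section \<open>Interiors of the Selmer space and its cells\<close>

lemma selmer_cell_low:
  "selmer_cell e (n - 1) = {y \<in> selmer_simplex e.
    coord e y (n - 1) + coord e y n > 1 \<and> coord e y n \<le> 1 / 2}"
  and selmer_cell_high:
  "selmer_cell e n = {y \<in> selmer_simplex e. coord e y n > 1 / 2}"
proof -
  show "selmer_cell e (n - 1) = {y \<in> selmer_simplex e.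
    coord e y (n - 1) + coord e y n > 1 \<and> coord e y n \<le> 1 / 2}"
    using n_ge_2 by (auto simp: selmer_cell_def n_eq)
  \<comment> \<open>For the digit n the second condition of the cell reads 1 - y_n >= 0, because of
    the default value y_(n+1) = 0; it holds on the whole simplex.\<close>
  have "coord e y n \<le> 1" if "y \<in> selmer_simplex e" for y
  proof -
    have "coord e y i \<le> 1" if "i \<le> n" for i
      using that
    proof (induction i)
      case (Suc i)
      then have "coord e y (i + 1) \<le> coord e y i"
        using \<open>y \<in> selmer_simplex e\<close> by (simp add: selmer_simplex_def n_eq)
      then show ?case
        using Suc by simp
    qed (simp add: coord_0)
    then show ?thesis
      by simp
  qed
  then show "selmer_cell e n = {y \<in> selmer_simplex e. coord e y n > 1 / 2}"
    by (auto simp: selmer_cell_def n_eq coord_beyond)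
qed

lemma selmer_simplex_last:
  assumes "y \<in> selmer_simplex e"
  shows "coord e y n \<le> coord e y (n - 1)"
proof -
  have "coord e y (n - 1 + 1) \<le> coord e y (n - 1)"
    using assms unfolding selmer_simplex_def n_eq by simp
  then show ?thesis
    using n_ge_2 by simp
qed

text \<open>The cells are separated by y_n = 1/2, and above this value the condition on the sum
  follows from y_(n-1) >= y_n.\<close>

lemma selmer_space_eq:
  "selmer_space e = {y \<in> selmer_simplex e. coord e y (n - 1) + coord e y n > 1}"
proof -
  have "coord e y (n - 1) + coord e y n > 1" if "y \<in> selmer_simplex e" "coord e y n > 1 / 2" for y
    using selmer_simplex_last[OF that(1)] that(2) by linarith
  then show ?thesis
    unfolding selmer_space_def n_eq selmer_cell_low selmer_cell_high by auto
qed

lemma slack_coord_pos_iff: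
  "(\<forall>j\<le>n. slack n (coord e y) j > 0) \<longleftrightarrow>
    (\<forall>i<n. coord e y i > coord e y (Suc i)) \<and> coord e y (n - 1) + coord e y n > 1"
  by (rule slack_pos_iff) (simp_all add: n_ge_2 coord_0)

lemma slack_pos_imp_selmer_space:
  assumes "\<forall>j\<le>n. slack n (coord e y) j > 0"
  shows "y \<in> selmer_space e"
proof -
  have dec: "\<forall>i<n. coord e y i > coord e y (Suc i)"
    and sum: "coord e y (n - 1) + coord e y n > 1"
    using assms slack_coord_pos_iff by blast+
  have "coord e y i \<le> 1" if "i \<le> n" for i
    using that
  proof (induction i)
    case (Suc i)
    then show ?case
      using spec[OF dec, of i] by simp
  qed (simp add: coord_0)
  \<comment> \<open>The inequality y_n > 0 is not among the slacks; it follows from y_(n-1) <= 1 and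
    y_(n-1) + y_n > 1.\<close>
  from this[of "n - 1"] have "coord e y n > 0"
    using sum by simp
  then have "coord e y i \<ge> coord e y (i + 1)" if "i \<le> n" for i
    using dec that coord_beyond[of "n + 1"] by (cases "i = n") (auto simp: less_imp_le)
  then show ?thesis
    using sum by (simp add: selmer_space_eq selmer_simplex_def n_eq)
qed

lemma interior_selmer_space_imp:
  assumes "y \<in> interior (selmer_space e)"
  shows "\<forall>j\<le>n. slack n (coord e y) j > 0"
proof -
  have "coord e y i > coord e y (Suc i)" if "i < n" for i
  proof -
    \<comment> \<open>Raising the smaller coordinate covers \<open>i = 0\<close> as well, since the
      entry with index 0 stays 1. The condition on the sum is strict by definition and needs no
      perturbation.\<close>
    obtain t where t: "t > 0" "y + axis (e (Suc i)) t \<in> selmer_space e"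
      using interior_axis_perturb[OF assms] by metis
    then have "coord e (y + axis (e (Suc i)) t) i \<ge> coord e (y + axis (e (Suc i)) t) (Suc i)"
      using that by (auto simp: selmer_space_eq selmer_simplex_def n_eq)
    then show ?thesis
      using t(1) that by (simp add: coord_add_axis)
  qed
  moreover have "coord e y (n - 1) + coord e y n > 1"
    using assms interior_subset by (auto simp: selmer_space_eq)
  ultimately show ?thesis
    by (simp add: slack_coord_pos_iff)
qed

lemma interior_selmer_space:
  "interior (selmer_space e) = {y. \<forall>j\<le>n. slack n (coord e y) j > 0}"
proof (rule interior_unique)
  show "{y. \<forall>j\<le>n. slack n (coord e y) j > 0} \<subseteq> selmer_space e"
    using slack_pos_imp_selmer_space by blast
  show "T \<subseteq> {y. \<forall>j\<le>n. slack n (coord e y) j > 0}" if "T \<subseteq> selmer_space e" "open T" for T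
    using interior_maximal[OF that] interior_selmer_space_imp by auto
qed (rule open_slack_pos)

text \<open>Since y_(n-1) cancels, the boundary y_n = 1/2 between the cells becomes equality of the
  last two slacks, the form in which it is compared with x_(n-1) = x_n.\<close>

lemma slack_last_eq:
  "slack n (coord e y) (n - 1) - slack n (coord e y) n = 2 * coord e y n - 1"
  using n_ge_2 by (simp add: slack_def coord_0)

lemma selmer_cell_low':
  "selmer_cell e (n - 1) =
    {y \<in> selmer_space e. slack n (coord e y) (n - 1) \<le> slack n (coord e y) n}"
  and selmer_cell_high':
  "selmer_cell e n =
    {y \<in> selmer_space e. slack n (coord e y) n < slack n (coord e y) (n - 1)}"
proof -
  have *: "slack n (coord e y) (n - 1) \<le> slack n (coord e y) n \<longleftrightarrow> coord e y n \<le> 1 / 2"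
    "slack n (coord e y) n < slack n (coord e y) (n - 1) \<longleftrightarrow> coord e y n > 1 / 2" for y
    using slack_last_eq[of y] by auto
  show "selmer_cell e (n - 1) =
    {y \<in> selmer_space e. slack n (coord e y) (n - 1) \<le> slack n (coord e y) n}"
    unfolding * selmer_cell_low selmer_space_eq by auto
  show "selmer_cell e n =
    {y \<in> selmer_space e. slack n (coord e y) n < slack n (coord e y) (n - 1)}"
    unfolding * selmer_space_def n_eq selmer_cell_low selmer_cell_high by auto
qed

lemma interior_selmer_cell_low:
  "interior (selmer_cell e (n - 1)) =
    {y. (\<forall>j\<le>n. slack n (coord e y) j > 0) \<and>
        slack n (coord e y) (n - 1) < slack n (coord e y) n}" (is "_ = ?O")
proof
  show "interior (selmer_cell e (n - 1)) \<subseteq> ?O"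
  proof
    fix y assume y: "y \<in> interior (selmer_cell e (n - 1))"
    moreover have "interior (selmer_cell e (n - 1)) \<subseteq> interior (selmer_space e)"
      unfolding selmer_cell_low' by (intro interior_mono) auto
    ultimately have "\<forall>j\<le>n. slack n (coord e y) j > 0"
      using interior_selmer_space by blast
    moreover obtain t where t: "t > 0" "y + axis (e n) t \<in> selmer_cell e (n - 1)"
      using interior_axis_perturb[OF y] by metis
    have "coord e y n < 1 / 2"
      using t n_ge_2 unfolding selmer_cell_low by (auto simp: coord_add_axis)
    then have "slack n (coord e y) (n - 1) < slack n (coord e y) n"
      using slack_last_eq[of y] by simp
    ultimately show "y \<in> ?O"
      by simp
  qed
  have "?O = {y. \<forall>j\<le>n. slack n (coord e y) j > 0} \<inter>
      {y. slack n (coord e y) (n - 1) < slack n (coord e y) n}"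
    by auto
  then have "open ?O"
    by (simp only:) (intro open_Int open_slack_pos open_Collect_less continuous_on_slack_coord)
  then show "?O \<subseteq> interior (selmer_cell e (n - 1))"
    using slack_pos_imp_selmer_space unfolding selmer_cell_low'
    by (intro interior_maximal) auto
qed

text \<open>The inequality that separates this cell is already strict, so the cell is the Selmer
  space cut by an open set and its interior is the corresponding intersection.\<close>

lemma interior_selmer_cell_high:
  "interior (selmer_cell e n) =
    {y. (\<forall>j\<le>n. slack n (coord e y) j > 0) \<and>
        slack n (coord e y) n < slack n (coord e y) (n - 1)}" (is "_ = ?O")
proof -
  have "selmer_cell e n =
      selmer_space e \<inter> {y. slack n (coord e y) n < slack n (coord e y) (n - 1)}"
    by (auto simp: selmer_cell_high')
  moreover have "open {y. slack n (coord e y) n < slack n (coord e y) (n - 1)}"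
    by (intro open_Collect_less continuous_on_slack_coord)
  ultimately show ?thesis
    by (auto simp: interior_selmer_space interior_open)
qed

section \<open>The matrix over its index type\<close>

text \<open>Inverse on \<open>{..n}\<close> to the map \<open>case_option 0 (index_of e)\<close> by
  which \<open>matrix_of_entries\<close> reads its indices; it turns sums over the option type into
  sums over \<open>{..n}\<close>.\<close>

definition option_index :: "nat \<Rightarrow> 'n option"
  where "option_index i = (if i = 0 then None else Some (e i))"

lemma bij_option_index: "bij_betw option_index {..n} UNIV"
proof (rule bij_betw_byWitness)
  show "\<forall>i\<in>{..n}. case_option 0 (index_of e) (option_index i) = i"
    by (auto simp: option_index_def index_of_e)
  show "\<forall>r\<in>UNIV. option_index (case_option 0 (index_of e) r) = r"
  proof
    show "option_index (case_option 0 (index_of e) r) = r" for r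
      using index_of_in[of "the r"] by (cases r) (auto simp: option_index_def e_index_of)
  qed
  show "range (case_option 0 (index_of e)) \<subseteq> {..n}"
    using index_of_in by (auto split: option.split)
qed auto

lemma selmer_dual_matrix_nth:
  assumes "i \<le> n" "j \<le> n"
  shows "selmer_dual_matrix e $ option_index i $ option_index j = selmer_entry n i j"
  using assms by (auto simp: selmer_dual_matrix_def matrix_of_entries_def Let_def n_eq
      selmer_entry_def option_index_def index_of_e)

lemma selmer_dual_matrix_mult:
  assumes "i \<le> n"
  shows "(selmer_dual_matrix e *v v) $ option_index i =
    selmer_apply n (\<lambda>j. v $ option_index j) i"
proof -
  have "(selmer_dual_matrix e *v v) $ option_index i =
      (\<Sum>j\<le>n. selmer_dual_matrix e $ option_index i $ option_index j * v $ option_index j)"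
    unfolding matrix_vector_mult_def vec_lambda_beta
    by (rule sum.reindex_bij_betw[OF bij_option_index, symmetric])
  also have "\<dots> = selmer_apply n (\<lambda>j. v $ option_index j) i"
    using assms by (simp add: selmer_apply_def selmer_dual_matrix_nth)
  finally show ?thesis .
qed

text \<open>For a square matrix a trivial kernel suffices, and \<open>slack\<close> recovers a
  vector from its image.\<close>

lemma invertible_selmer_dual_matrix: "invertible (selmer_dual_matrix e)"
proof -
  have "v = 0" if "selmer_dual_matrix e *v v = 0" for v
  proof -
    define f where "f = (\<lambda>j. v $ option_index j)"
    have zero: "selmer_apply n f i = 0" if "i \<le> n" for i
      using selmer_dual_matrix_mult[OF that, of v] \<open>selmer_dual_matrix e *v v = 0\<close>
      by (simp add: f_def)
    have f: "f j = 0" if "j \<le> n" for j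
    proof -
      have "f j = slack n (selmer_apply n f) j"
        using slack_selmer_apply[OF n_ge_2 that] by simp
      also have "\<dots> = slack n (\<lambda>_. 0) j"
        by (rule slack_cong) (rule zero)
      finally show ?thesis
        by (simp add: slack_def)
    qed
    show "v = 0"
    proof (subst vec_eq_iff, rule allI)
      fix r
      have "r \<in> option_index ` {..n}"
        using bij_betw_imp_surj_on[OF bij_option_index] by simp
      then obtain j where "j \<le> n" "option_index j = r"
        by auto
      then show "v $ r = 0 $ r"
        using f[of j] by (simp add: f_def)
    qed
  qed
  then show ?thesis
    by (simp add: invertible_left_inverse matrix_left_invertible_ker)
qed

lemma transpose_selmer_dual_matrix: "transpose (selmer_dual_matrix e) = selmer_dual_matrix e"
  by (auto simp: transpose_def selmer_dual_matrix_def matrix_of_entries_def Let_def vec_eq_iff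
      add.commute)

definition homog :: "real^'n \<Rightarrow> real^'n option"
  where "homog x = (\<chi> r. case r of None \<Rightarrow> 1 | Some k \<Rightarrow> x $ k)"

lemma homog_option_index: "j \<le> n \<Longrightarrow> homog x $ option_index j = coord e x j"
  by (simp add: homog_def option_index_def coord_def n_eq)

text \<open>The right-hand sides are the numerators and the denominator in
  \<open>frac_linear\<close>.\<close>

lemma row_homog:
  "(A *v homog x) $ r = A $ r $ None + (\<Sum>j\<in>UNIV. A $ r $ Some j * x $ j)"
  by (simp add: matrix_vector_mult_def homog_def UNIV_option_conv sum.reindex)

lemma selmer_row:
  assumes "i \<le> n"
  shows "(selmer_dual_matrix e *v homog x) $ option_index i = selmer_apply n (coord e x) i"
  using selmer_dual_matrix_mult[OF assms] homog_option_index
  by (simp cong: selmer_apply_cong)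

section \<open>The map \<open>\<phi>\<close> and its inverse\<close>

abbreviation \<phi> :: "real^'n \<Rightarrow> real^'n"
  where "\<phi> \<equiv> frac_linear (selmer_dual_matrix e)"

lemma denominator_eq:
  "selmer_dual_matrix e $ None $ None + (\<Sum>j\<in>UNIV. selmer_dual_matrix e $ None $ Some j * x $ j)
    = selmer_apply n (coord e x) 0"
  using selmer_row[of 0 x] row_homog[of "selmer_dual_matrix e" x None]
  by (simp add: option_index_def)

lemma coord_phi:
  assumes "i \<le> n" "selmer_apply n (coord e x) 0 \<noteq> 0"
  shows "coord e (\<phi> x) i = selmer_apply n (coord e x) i / selmer_apply n (coord e x) 0"
proof (cases "i = 0")
  case True
  then show ?thesis
    using assms by (simp add: coord_0)
next
  case False
  then have "selmer_dual_matrix e $ Some (e i) $ None +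
      (\<Sum>j\<in>UNIV. selmer_dual_matrix e $ Some (e i) $ Some j * x $ j) =
      selmer_apply n (coord e x) i"
    using selmer_row[OF assms(1), of x] row_homog[of "selmer_dual_matrix e" x "Some (e i)"]
    by (simp add: option_index_def)
  then show ?thesis
    using False assms by (simp add: coord_def n_eq frac_linear_def denominator_eq)
qed

text \<open>Division by the denominator commutes with \<open>slack\<close>, which inverts the
  matrix. Thus the slacks at the image are the coordinates of \<open>x\<close> up to one common
  factor.\<close>

lemma slack_coord_phi:
  assumes "j \<le> n" "selmer_apply n (coord e x) 0 \<noteq> 0"
  shows "slack n (coord e (\<phi> x)) j = coord e x j / selmer_apply n (coord e x) 0"
proof -
  have "slack n (coord e (\<phi> x)) j =
      slack n (\<lambda>i. selmer_apply n (coord e x) i / selmer_apply n (coord e x) 0) j"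
    by (rule slack_cong) (simp add: coord_phi assms)
  then show ?thesis
    by (simp add: slack_divide slack_selmer_apply n_ge_2 assms)
qed

text \<open>The fractional linear map of the inverse matrix, with the slack of index 0 as
  denominator.\<close>

definition \<psi> :: "real^'n \<Rightarrow> real^'n"
  where "\<psi> y = of_coords e (\<lambda>i. slack n (coord e y) i / slack n (coord e y) 0)"

lemma coord_psi:
  assumes "i \<le> n" "slack n (coord e y) 0 \<noteq> 0"
  shows "coord e (\<psi> y) i = slack n (coord e y) i / slack n (coord e y) 0"
  using assms by (cases "i = 0") (simp_all add: \<psi>_def coord_of_coords coord_0)

lemma psi_phi:
  assumes "selmer_apply n (coord e x) 0 \<noteq> 0"
  shows "\<psi> (\<phi> x) = x"
proof (rule coord_eqI)
  fix i assume "i \<in> {1..n}"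
  then show "coord e (\<psi> (\<phi> x)) i = coord e x i"
    using assms by (simp add: coord_psi slack_coord_phi coord_0)
qed

lemma selmer_apply_coord_psi:
  assumes "i \<le> n" "slack n (coord e y) 0 \<noteq> 0"
  shows "selmer_apply n (coord e (\<psi> y)) i = coord e y i / slack n (coord e y) 0"
proof -
  have "selmer_apply n (coord e (\<psi> y)) i =
      selmer_apply n (\<lambda>i. slack n (coord e y) i / slack n (coord e y) 0) i"
    using assms by (intro selmer_apply_cong) (simp add: coord_psi)
  then show ?thesis
    using assms by (simp add: selmer_apply_divide selmer_apply_slack n_ge_2)
qed

lemma phi_psi:
  assumes "slack n (coord e y) 0 \<noteq> 0"
  shows "\<phi> (\<psi> y) = y"
proof (rule coord_eqI)
  fix i assume "i \<in> {1..n}"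
  then show "coord e (\<phi> (\<psi> y)) i = coord e y i"
    using assms by (simp add: coord_phi selmer_apply_coord_psi coord_0)
qed

text \<open>The assumption says that \<open>R\<close> is invariant under positive scaling, so the
  denominators do not affect it, and sees only indices up to \<open>n\<close>, beyond which
  \<open>coord\<close> and \<open>slack\<close> need not match. One proof thus serves the whole
  space and both cells.\<close>

lemma bij_phi:
  assumes R: "\<And>c f g. c > 0 \<Longrightarrow> (\<And>i. i \<le> n \<Longrightarrow> g i = f i / c) \<Longrightarrow> R g \<longleftrightarrow> R f"
  shows "bij_betw \<phi> {x. (\<forall>i\<le>n. coord e x i > 0) \<and> R (coord e x)}
    {y. (\<forall>j\<le>n. slack n (coord e y) j > 0) \<and> R (slack n (coord e y))}"
proof (rule bij_betw_byWitness[where f' = \<psi>])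
  let ?P = "{x. (\<forall>i\<le>n. coord e x i > 0) \<and> R (coord e x)}"
  let ?Q = "{y. (\<forall>j\<le>n. slack n (coord e y) j > 0) \<and> R (slack n (coord e y))}"
  have pos: "selmer_apply n (coord e x) 0 > 0" if "x \<in> ?P" for x
    using that n_ge_2 by (intro selmer_apply_pos) auto
  show "\<forall>x\<in>?P. \<psi> (\<phi> x) = x"
    using pos by (intro ballI psi_phi) fastforce
  show "\<forall>y\<in>?Q. \<phi> (\<psi> y) = y"
    by (intro ballI phi_psi) fastforce
  show "\<phi> ` ?P \<subseteq> ?Q"
  proof (rule image_subsetI)
    fix x assume x: "x \<in> ?P"
    have slack: "slack n (coord e (\<phi> x)) j = coord e x j / selmer_apply n (coord e x) 0"
      if "j \<le> n" for j
      using that pos[OF x] by (simp add: slack_coord_phi)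
    have "R (slack n (coord e (\<phi> x))) \<longleftrightarrow> R (coord e x)"
      by (rule R[OF pos[OF x]]) (rule slack)
    with x pos[OF x] show "\<phi> x \<in> ?Q"
      by (simp add: slack)
  qed
  show "\<psi> ` ?Q \<subseteq> ?P"
  proof (rule image_subsetI)
    fix y assume y: "y \<in> ?Q"
    then have pos: "slack n (coord e y) 0 > 0"
      by simp
    have coord: "coord e (\<psi> y) i = slack n (coord e y) i / slack n (coord e y) 0"
      if "i \<le> n" for i
      using that pos by (simp add: coord_psi)
    have "R (coord e (\<psi> y)) \<longleftrightarrow> R (slack n (coord e y))"
      by (rule R[OF pos]) (rule coord)
    with y pos show "\<psi> y \<in> ?P"
      by (simp add: coord)
  qed
qed

lemma bij_phi_space: "bij_betw \<phi> (interior dual_space) (interior (selmer_space e))"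
  using bij_phi[of "\<lambda>_. True"] by (simp add: interior_dual_space interior_selmer_space)

lemma phi_dual_cell_low: "\<phi> ` interior (dual_cell e (n - 1)) = interior (selmer_cell e (n - 1))"
  unfolding interior_dual_cell_low interior_selmer_cell_low
  by (intro bij_betw_imp_surj_on bij_phi[of "\<lambda>f. f (n - 1) < f n"]) (simp add: divide_less_cancel)

lemma phi_dual_cell_high: "\<phi> ` interior (dual_cell e n) = interior (selmer_cell e n)"
  unfolding interior_dual_cell_high interior_selmer_cell_high
  by (intro bij_betw_imp_surj_on bij_phi[of "\<lambda>f. f n < f (n - 1)"]) (simp add: divide_less_cancel)

section \<open>The intertwining relation\<close>

text \<open>
  The sequences \<open>f\<close> and \<open>g\<close> are homogeneous coordinates of the images under the dual map and under
  the Selmer map, so only their ratios matter.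
\<close>

lemma phi_eqI:
  assumes x: "\<And>i. i \<le> n \<Longrightarrow> coord e x i = f i / f 0"
    and y: "\<And>i. i \<le> n \<Longrightarrow> coord e y i = g i / g 0"
    and slack: "\<And>j. j \<le> n \<Longrightarrow> slack n g j = f j"
    and nz: "f 0 \<noteq> 0" "g 0 \<noteq> 0"
  shows "\<phi> x = y"
proof (rule coord_eqI)
  fix i assume i: "i \<in> {1..n}"
  have apply_x: "selmer_apply n (coord e x) i = g i / f 0" if "i \<le> n" for i
  proof -
    have "selmer_apply n (coord e x) i = selmer_apply n (\<lambda>i. slack n g i / f 0) i"
      by (rule selmer_apply_cong) (simp add: x slack)
    then show ?thesis
      using that by (simp add: selmer_apply_divide selmer_apply_slack n_ge_2)
  qed
  show "coord e (\<phi> x) i = coord e y i"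
    using i nz by (simp add: coord_phi apply_x y)
qed

lemma intertwine_low:
  assumes x: "x \<in> interior (dual_cell e (n - 1))"
  shows "\<phi> (dual_map e x) = selmer_map e (\<phi> x)"
proof -
  define f where "f = coord e x"
  define g where "g = selmer_apply n f"
  \<comment> \<open>The primed sequences are the images under the two maps with denominators
    cleared: \<open>f'\<close> belongs to \<open>dual_map e x\<close>, with denominator
    \<open>f (n - 1)\<close>, and \<open>g'\<close> to \<open>selmer_map e (\<phi> x)\<close>, with
    denominator \<open>g 1\<close>.\<close>
  define f' where "f' = (\<lambda>i. if i = 0 then f (n - 1) else if i < n then f (i - 1) else f n - f (n - 1))"
  define g' where "g' = (\<lambda>i. if i + 1 < n then g (i + 1) else if i + 1 = n then g 0 - g n else g n)"
  have f_pos: "f i > 0" if "i \<le> n" for i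
    using x that unfolding interior_dual_cell_low f_def by simp
  have g_pos: "g i > 0" if "i \<le> n" for i
    unfolding g_def using that f_pos n_ge_2 by (intro selmer_apply_pos) auto
  have phi: "coord e (\<phi> x) i = g i / g 0" if "i \<le> n" for i
    using that g_pos[of 0] by (simp add: coord_phi g_def f_def)
  have slack_g: "slack n g j = f j" if "j \<le> n" for j
    using that n_ge_2 by (simp add: g_def slack_selmer_apply)
  have g'0: "g' 0 = g 1"
    using n_ge_2 by (simp add: g'_def)
  have "x \<in> dual_cell e (n - 1)"
    using x interior_subset by blast
  then have x': "coord e (dual_map e x) i = f' i / f' 0" if "i \<le> n" for i
    using that n_ge_2 f_pos[of "n - 1"]
    by (cases "i = 0")
      (auto simp: dual_map_def n_eq Let_def coord_0 coord_of_coords f'_def f_def)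
  have "\<phi> x \<in> selmer_cell e (n - 1)"
    using x phi_dual_cell_low interior_subset by blast
  then have map: "coord e (selmer_map e (\<phi> x)) i =
      (if i < n - 1 then coord e (\<phi> x) (i + 1) / coord e (\<phi> x) 1
       else if i = n - 1 then (1 - coord e (\<phi> x) n) / coord e (\<phi> x) 1
       else coord e (\<phi> x) n / coord e (\<phi> x) 1)"
    if "i \<in> {1..n}" for i
    using that by (simp add: selmer_map_def n_eq Let_def coord_of_coords)
  have nz: "g 0 \<noteq> 0" "g 1 \<noteq> 0"
    using g_pos[of 0] g_pos[of 1] n_ge_2 by auto
  \<comment> \<open>The denominator \<open>g 0\<close> of \<open>\<phi>\<close> cancels when the
    Selmer map divides by its first coordinate.\<close>
  have quot: "a / g 0 / (g 1 / g 0) = a / g 1" "(1 - a / g 0) / (g 1 / g 0) = (g 0 - a) / g 1" for a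
    using nz by (simp_all add: divide_simps)
  have y': "coord e (selmer_map e (\<phi> x)) i = g' i / g' 0" if "i \<le> n" for i
  proof (cases "i = 0")
    case True
    then show ?thesis
      using nz by (simp add: coord_0 g'0)
  next
    case False
    then have "i \<in> {1..n}"
      using that by simp
    moreover have "coord e (\<phi> x) 1 = g 1 / g 0"
      using n_ge_2 by (intro phi) simp
    moreover have "coord e (\<phi> x) n = g n / g 0"
      by (intro phi) simp
    moreover have "coord e (\<phi> x) (i + 1) = g (i + 1) / g 0" if "i < n"
      using that by (intro phi) simp
    ultimately show ?thesis
      unfolding g'0 using that
      by (auto simp: map quot g'_def simp del: One_nat_def divide_divide_eq_left divide_divide_eq_right)
  qed
  have "slack n g' j = f' j" if "j \<le> n" for j
    using that n_ge_2 by (simp only: g'_def f'_def slack_shift_low slack_g)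
  then show ?thesis
    using x' y' f_pos[of "n - 1"] g_pos[of 1] n_ge_2 by (intro phi_eqI[of _ f' _ g'])
     (auto simp: g'0 f'_def)
qed

lemma intertwine_high:
  assumes x: "x \<in> interior (dual_cell e n)"
  shows "\<phi> (dual_map e x) = selmer_map e (\<phi> x)"
proof -
  define f where "f = coord e x"
  define g where "g = selmer_apply n f"
  define f' where "f' = (\<lambda>i. if i = 0 then f n else if i < n then f (i - 1) else f (n - 1) - f n)"
  define g' where "g' = (\<lambda>i. if i < n then g (i + 1) else g 0 - g n)"
  have f_pos: "f i > 0" if "i \<le> n" for i
    using x that unfolding interior_dual_cell_high f_def by simp
  have g_pos: "g i > 0" if "i \<le> n" for i
    unfolding g_def using that f_pos n_ge_2 by (intro selmer_apply_pos) auto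
  have phi: "coord e (\<phi> x) i = g i / g 0" if "i \<le> n" for i
    using that g_pos[of 0] by (simp add: coord_phi g_def f_def)
  have slack_g: "slack n g j = f j" if "j \<le> n" for j
    using that n_ge_2 by (simp add: g_def slack_selmer_apply)
  have g'0: "g' 0 = g 1"
    using n_ge_2 by (simp add: g'_def)
  \<comment> \<open>On the common boundary \<open>dual_map\<close> takes its first branch; the
    strict inequality in the interior forces the second one.\<close>
  have "x \<notin> dual_cell e (n - 1)"
    using x unfolding interior_dual_cell_high dual_cell_low by simp
  then have x': "coord e (dual_map e x) i = f' i / f' 0" if "i \<le> n" for i
    using that n_ge_2 f_pos[of n]
    by (cases "i = 0")
      (auto simp: dual_map_def n_eq Let_def coord_0 coord_of_coords f'_def f_def)
  have "\<phi> x \<in> selmer_cell e n"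
    using x phi_dual_cell_high interior_subset by blast
  then have "\<phi> x \<notin> selmer_cell e (n - 1)"
    unfolding selmer_cell_low' selmer_cell_high' by simp
  then have map: "coord e (selmer_map e (\<phi> x)) i =
      (if i < n then coord e (\<phi> x) (i + 1) / coord e (\<phi> x) 1 else (1 - coord e (\<phi> x) n) / coord e (\<phi> x) 1)"
    if "i \<in> {1..n}" for i
    using that by (simp add: selmer_map_def n_eq Let_def coord_of_coords)
  have nz: "g 0 \<noteq> 0" "g 1 \<noteq> 0"
    using g_pos[of 0] g_pos[of 1] n_ge_2 by auto
  have quot: "a / g 0 / (g 1 / g 0) = a / g 1" "(1 - a / g 0) / (g 1 / g 0) = (g 0 - a) / g 1" for a
    using nz by (simp_all add: divide_simps)
  have y': "coord e (selmer_map e (\<phi> x)) i = g' i / g' 0" if "i \<le> n" for i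
  proof (cases "i = 0")
    case True
    then show ?thesis
      using nz by (simp add: coord_0 g'0)
  next
    case False
    then have "i \<in> {1..n}"
      using that by simp
    moreover have "coord e (\<phi> x) 1 = g 1 / g 0"
      using n_ge_2 by (intro phi) simp
    moreover have "coord e (\<phi> x) n = g n / g 0"
      by (intro phi) simp
    moreover have "coord e (\<phi> x) (i + 1) = g (i + 1) / g 0" if "i < n"
      using that by (intro phi) simp
    ultimately show ?thesis
      unfolding g'0 using that
      by (auto simp: map quot g'_def simp del: One_nat_def divide_divide_eq_left divide_divide_eq_right)
  qed
  have "slack n g' j = f' j" if "j \<le> n" for j
    using that n_ge_2 by (simp only: g'_def f'_def slack_shift_high slack_g)
  then show ?thesis
    using x' y' f_pos[of n] g_pos[of 1] n_ge_2 by (intro phi_eqI[of _ f' _ g'])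
     (auto simp: g'0 f'_def)
qed

section \<open>Differentiability and conclusion\<close>

lemma phi_differentiable_on: "\<phi> differentiable_on interior dual_space"
proof (rule differentiable_at_imp_differentiable_on)
  fix x :: "real^'n" assume "x \<in> interior dual_space"
  then have "selmer_apply n (coord e x) 0 > 0"
    using n_ge_2 by (intro selmer_apply_pos) (auto simp: interior_dual_space)
  then show "\<phi> differentiable (at x)"
    by (intro differentiable_frac_linear) (simp add: denominator_eq)
qed

lemma selmer_self_dual:
  "algebraic_self_dual_via (selmer_digits TYPE('n)) (selmer_space e) (selmer_cell e)
    (selmer_map e) dual_space (dual_cell e) (dual_map e) \<phi>"
  unfolding algebraic_self_dual_via_def
proof (intro conjI)
  show "\<phi> \<in> borel_measurable (restrict_space borel (interior dual_space))"
    by (rule borel_measurable_continuous_on_restrict[OF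
        differentiable_imp_continuous_on[OF phi_differentiable_on]])
  show "\<forall>k\<in>selmer_digits TYPE('n). \<phi> ` interior (dual_cell e k) = interior (selmer_cell e k) \<and>
    (\<forall>x\<in>interior (dual_cell e k). \<phi> (dual_map e x) = selmer_map e (\<phi> x))"
  proof
    fix k assume "k \<in> selmer_digits TYPE('n)"
    then consider (low) "k = n - 1" | (high) "k = n"
      by (auto simp: selmer_digits_def n_eq)
    then show "\<phi> ` interior (dual_cell e k) = interior (selmer_cell e k) \<and>
      (\<forall>x\<in>interior (dual_cell e k). \<phi> (dual_map e x) = selmer_map e (\<phi> x))"
    proof cases
      case low
      show ?thesis
        unfolding low using phi_dual_cell_low intertwine_low by (intro conjI ballI)
    next
      case high
      show ?thesis
        unfolding high using phi_dual_cell_high intertwine_high by (intro conjI ballI)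
    qed
  qed
qed (rule bij_phi_space phi_differentiable_on)+

end

theorem proposition3:
  fixes e :: "nat \<Rightarrow> 'n::finite"
  assumes "CARD('n) \<ge> 2"
    and "numbering e"
  shows "transpose (selmer_dual_matrix e) = selmer_dual_matrix e \<and>
    invertible (selmer_dual_matrix e) \<and>
    algebraic_self_dual_via (selmer_digits TYPE('n))
      (selmer_space e) (selmer_cell e) (selmer_map e)
      dual_space (dual_cell e) (dual_map e)
      (frac_linear (selmer_dual_matrix e))"
  using transpose_selmer_dual_matrix[OF assms(1) refl assms(2)]
    invertible_selmer_dual_matrix[OF assms(1) refl assms(2)]
    selmer_self_dual[OF assms(1) refl assms(2)]
  by blast

end
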